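(* Let $0<\theta<p<\infty$, $0<q\le\infty$ and $j\in\mathbb{Z}$. Let $\{t_k\}_{k\in\mathbb{Z}}$ be a $p$-admissible weight sequence belonging to $\dot X_{\sigma,p}$ with $\sigma=(\sigma_1,\sigma_2)$, $\sigma_1=\theta\left(\frac{p}{\theta}\right)'$ and $\sigma_2\ge p$. Then, both for $\dot A=\dot B$ and for $\dot A=\dot F$, $$\dot A_{p,q}(\mathbb{R}^n,\{t_k\})=\dot A_{p,q}(\mathbb{R}^n,t_j)$$ in the sense of equivalent quasi-norms.
   Context: A weight is a nonnegative locally integrable function on $\mathbb{R}^n$ with values in $(0,\infty)$ a.e. For $1\le r\le\infty$, $r'$ is the conjugate exponent. All cubes have sides parallel to the axes. For $0<s<\infty$ put $M_{Q,s}(f)=\big(\frac1{|Q|}\int_Q|f|^s\,dx\big)^{1/s}$, and $M_{Q,\infty}(f)=\operatorname{ess\,sup}_Q|f|$. A weight sequence $\{t_k\}_{k\in\mathbb{Z}}$ is $p$-admissible if $t_k\in L_p^{\mathrm{loc}}(\mathbb{R}^n)$ for all $k$. It belongs to $\dot X_{\sigma,p}$, $\sigma=(\sigma_1,\sigma_2)\in(0,\infty]^2$, if there are constants $C_1,C_2>0$ such that for all integers $k\le j$ and every cube $Q$, $$M_{Q,p}(t_k)\,M_{Q,\sigma_1}(t_j^{-1})\le C_1,\qquad (M_{Q,p}(t_k))^{-1}M_{Q,\sigma_2}(t_j)\le C_2 .$$ Let $\mathcal{S}_\infty(\mathbb{R}^n)$ be the space of Schwartz functions all of whose moments vanish ($\int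 x^\beta\varphi(x)\,dx=0$ for all $\beta\in\mathbb{N}_0^n$), and $\mathcal{S}_\infty'(\mathbb{R}^n)$ its topological dual. Fix $\varphi\in\mathcal{S}(\mathbb{R}^n)$ whose Fourier transform satisfies $\operatorname{supp}\mathcal{F}\varphi\subset\{\frac12\le|\xi|\le2\}$ and $|\mathcal{F}\varphi(\xi)|\ge c>0$ for $\frac35\le|\xi|\le\frac53$; put $\varphi_k(x)=2^{kn}\varphi(2^kx)$. $\dot B_{p,q}(\mathbb{R}^n,\{t_k\})$ is the set of $f\in\mathcal{S}'_\infty(\mathbb{R}^n)$ with $\big(\sum_{k\in\mathbb{Z}}\|t_k(\varphi_k*f)\|_{L_p(\mathbb{R}^n)}^q\big)^{1/q}<\infty$, and $\dot F_{p,q}(\mathbb{R}^n,\{t_k\})$ is the set of $f\in\mathcal{S}'_\infty(\mathbb{R}^n)$ with $\big\|\big(\sum_{k\in\mathbb{Z}}t_k^q|\varphi_k*f|^q\big)^{1/q}\big\|_{L_p(\mathbb{R}^n)}<\infty$ (suprema over $k$ if $q=\infty$); these expressions are the quasi-norms. For a single weight $t$, $\dot A_{p,q}(\mathbb{R}^n,t)$ denotes the space $\dot A_{p,q}(\mathbb{R}^n,\{s_k\})$ with $s_k=t$ for every $k\in\mathbb{Z}$. *)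

theory Defs
  imports "HOL-Analysis.Analysis" "HOL-Probability.Essential_Supremum"
begin

section \<open>Exponents\<close>

text \<open>Real powers on \<open>[0,\<infinity>]\<close>; only exponents \<open>s > 0\<close> are used, so that \<open>\<infinity>\<close> is sent to \<open>\<infinity>\<close>.\<close>

definition epowr :: "ennreal \<Rightarrow> real \<Rightarrow> ennreal" (infixr \<open>epowr\<close> 80) where
  "x epowr s = (if x = \<infinity> then \<infinity> else ennreal (enn2real x powr s))"

text \<open>\<open>1/r + 1/r' = 1\<close> for \<open>1 \<le> r \<le> \<infinity>\<close>, with \<open>1/0 = \<infinity>\<close> and \<open>1/\<infinity> = 0\<close> in \<^typ>\<open>ennreal\<close>.\<close>

definition conj_exponent :: "ennreal \<Rightarrow> ennreal" where
  "conj_exponent r = inverse (1 - inverse r)"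

section \<open>Weights\<close>

text \<open>Weights take values in \<open>[0,\<infinity>]\<close>, so that \<open>1/t\<close> makes sense everywhere; the values
  \<open>0\<close> and \<open>\<infinity>\<close> are attained on a null set only.\<close>

definition weight :: "(real^'n \<Rightarrow> ennreal) \<Rightarrow> bool" where
  "weight t \<longleftrightarrow> t \<in> borel_measurable lebesgue
     \<and> (\<forall>K. compact K \<longrightarrow> (\<integral>\<^sup>+x\<in>K. t x \<partial>lebesgue) < \<infinity>)
     \<and> (AE x in lebesgue. 0 < t x \<and> t x < \<infinity>)"

definition p_admissible :: "real \<Rightarrow> (int \<Rightarrow> real^'n \<Rightarrow> ennreal) \<Rightarrow> bool" where
  "p_admissible p t \<longleftrightarrow>
     (\<forall>k. weight (t k) \<and> (\<forall>K. compact K \<longrightarrow> (\<integral>\<^sup>+x\<in>K. t k x epowr p \<partial>lebesgue) < \<infinity>))"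

definition cube :: "(real^'n) set \<Rightarrow> bool" where
  "cube Q \<longleftrightarrow> (\<exists>a l. 0 < l \<and> Q = cbox a (\<chi> i. a $ i + l))"

definition M_mean :: "(real^'n) set \<Rightarrow> ennreal \<Rightarrow> (real^'n \<Rightarrow> ennreal) \<Rightarrow> ennreal" where
  "M_mean Q s f =
     (if s = \<infinity> then esssup (restrict_space lebesgue Q) f
      else ((\<integral>\<^sup>+x\<in>Q. f x epowr enn2real s \<partial>lebesgue) / emeasure lebesgue Q) epowr (1 / enn2real s))"

definition X_dot :: "ennreal \<times> ennreal \<Rightarrow> real \<Rightarrow> (int \<Rightarrow> real^'n \<Rightarrow> ennreal) set" where
  "X_dot \<sigma> p = {t. \<exists>C1 C2 :: real. 0 < C1 \<and> 0 < C2 \<and>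
     (\<forall>k j. k \<le> j \<longrightarrow> (\<forall>Q. cube Q \<longrightarrow>
        M_mean Q (ennreal p) (t k) * M_mean Q (fst \<sigma>) (\<lambda>x. inverse (t j x)) \<le> ennreal C1 \<and>
        inverse (M_mean Q (ennreal p) (t k)) * M_mean Q (snd \<sigma>) (t j) \<le> ennreal C2))}"

section \<open>Schwartz functions and distributions modulo polynomials\<close>

definition monomial :: "('n \<Rightarrow> nat) \<Rightarrow> real^'n \<Rightarrow> real" where
  "monomial \<beta> x = (\<Prod>i\<in>UNIV. (x $ i) ^ \<beta> i)"

definition partial_deriv :: "'n \<Rightarrow> (real^'n \<Rightarrow> complex) \<Rightarrow> real^'n \<Rightarrow> complex" where
  "partial_deriv i f = (\<lambda>x. frechet_derivative f (at x) (axis i 1))"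

text \<open>An iterated partial derivative is given by the list of its coordinate directions rather
  than by a multi-index, since on non-smooth functions the order of differentiation matters.
  On smooth functions the two descriptions give the same derivatives.\<close>

abbreviation iter_deriv :: "'n list \<Rightarrow> (real^'n \<Rightarrow> complex) \<Rightarrow> real^'n \<Rightarrow> complex" where
  "iter_deriv ds \<equiv> foldr partial_deriv ds"

definition smooth :: "(real^'n \<Rightarrow> complex) \<Rightarrow> bool" where
  "smooth f \<longleftrightarrow> (\<forall>ds x. iter_deriv ds f differentiable (at x))"

definition schwartz :: "(real^'n \<Rightarrow> complex) set" where
  "schwartz = {f. smooth f \<and>
     (\<forall>\<beta> ds. bounded (range (\<lambda>x. of_real (monomial \<beta> x) * iter_deriv ds f x)))}"

definition schwartz_seminorm ::
  "('n \<Rightarrow> nat) \<Rightarrow> 'n list \<Rightarrow> (real^'n \<Rightarrow> complex) \<Rightarrow> real" where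
  "schwartz_seminorm \<beta> ds f = (SUP x. norm (of_real (monomial \<beta> x) * iter_deriv ds f x))"

definition schwartz_topology :: "(real^'n \<Rightarrow> complex) topology" where
  "schwartz_topology = topology_generated_by
     {{g \<in> schwartz. schwartz_seminorm \<beta> ds (\<lambda>x. g x - f x) < \<epsilon>} | \<beta> ds f \<epsilon>.
        f \<in> schwartz \<and> 0 < \<epsilon>}"

definition schwartz_inf :: "(real^'n \<Rightarrow> complex) set" where
  "schwartz_inf = {\<phi> \<in> schwartz. \<forall>\<beta>. (LINT x|lebesgue. of_real (monomial \<beta> x) * \<phi> x) = 0}"

text \<open>The topological dual. Functionals are \<^const>\<open>extensional\<close>, so that they are determined by
  their values on \<^const>\<open>schwartz_inf\<close>.\<close>

definition schwartz_inf_dual :: "((real^'n \<Rightarrow> complex) \<Rightarrow> complex) set" where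
  "schwartz_inf_dual = {f \<in> extensional schwartz_inf.
     (\<forall>\<phi>\<in>schwartz_inf. \<forall>\<psi>\<in>schwartz_inf. f (\<lambda>x. \<phi> x + \<psi> x) = f \<phi> + f \<psi>) \<and>
     (\<forall>c. \<forall>\<phi>\<in>schwartz_inf. f (\<lambda>x. c * \<phi> x) = c * f \<phi>) \<and>
     continuous_map (subtopology schwartz_topology schwartz_inf) euclidean f}"

definition fourier :: "(real^'n \<Rightarrow> complex) \<Rightarrow> real^'n \<Rightarrow> complex" where
  "fourier \<phi> \<xi> = of_real ((2 * pi) powr (- real CARD('n) / 2)) *
     (LINT x|lebesgue. exp (- \<i> * of_real (x \<bullet> \<xi>)) * \<phi> x)"

definition admissible_kernel :: "(real^'n \<Rightarrow> complex) \<Rightarrow> bool" where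
  "admissible_kernel \<phi> \<longleftrightarrow> \<phi> \<in> schwartz \<and>
     closure {\<xi>. fourier \<phi> \<xi> \<noteq> 0} \<subseteq> {\<xi>. 1/2 \<le> norm \<xi> \<and> norm \<xi> \<le> 2} \<and>
     (\<exists>c>0. \<forall>\<xi>. 3/5 \<le> norm \<xi> \<and> norm \<xi> \<le> 5/3 \<longrightarrow> c \<le> norm (fourier \<phi> \<xi>))"

definition dilate :: "(real^'n \<Rightarrow> complex) \<Rightarrow> int \<Rightarrow> real^'n \<Rightarrow> complex" where
  "dilate \<phi> k x = of_real (2 powi (k * int CARD('n))) * \<phi> ((2 powi k) *\<^sub>R x)"

text \<open>\<open>(\<phi> * f)(x) = \<langle>f, \<phi>(x - \<cdot>)\<rangle>\<close>, where \<open>\<phi>(x - \<cdot>)\<close> has vanishing moments for the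
  kernels considered, as their Fourier transform vanishes near the origin.\<close>

definition conv ::
  "(real^'n \<Rightarrow> complex) \<Rightarrow> ((real^'n \<Rightarrow> complex) \<Rightarrow> complex) \<Rightarrow> real^'n \<Rightarrow> complex" where
  "conv \<phi> f x = f (\<lambda>y. \<phi> (x - y))"

section \<open>Besov and Triebel--Lizorkin spaces\<close>

definition Lp_norm :: "real \<Rightarrow> (real^'n \<Rightarrow> ennreal) \<Rightarrow> ennreal" where
  "Lp_norm p g = (\<integral>\<^sup>+x. g x epowr p \<partial>lebesgue) epowr (1 / p)"

definition lq_norm :: "ennreal \<Rightarrow> (int \<Rightarrow> ennreal) \<Rightarrow> ennreal" where
  "lq_norm q a =
     (if q = \<infinity> then (SUP k. a k)
      else (\<Sum>\<^sub>\<infinity>k\<in>UNIV. a k epowr enn2real q) epowr (1 / enn2real q))"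

definition B_norm ::
  "(real^'n \<Rightarrow> complex) \<Rightarrow> real \<Rightarrow> ennreal \<Rightarrow> (int \<Rightarrow> real^'n \<Rightarrow> ennreal) \<Rightarrow>
     ((real^'n \<Rightarrow> complex) \<Rightarrow> complex) \<Rightarrow> ennreal" where
  "B_norm \<phi> p q t f =
     lq_norm q (\<lambda>k. Lp_norm p (\<lambda>x. t k x * ennreal (norm (conv (dilate \<phi> k) f x))))"

definition F_norm ::
  "(real^'n \<Rightarrow> complex) \<Rightarrow> real \<Rightarrow> ennreal \<Rightarrow> (int \<Rightarrow> real^'n \<Rightarrow> ennreal) \<Rightarrow>
     ((real^'n \<Rightarrow> complex) \<Rightarrow> complex) \<Rightarrow> ennreal" where
  "F_norm \<phi> p q t f =
     Lp_norm p (\<lambda>x. lq_norm q (\<lambda>k. t k x * ennreal (norm (conv (dilate \<phi> k) f x))))"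

definition B_space ::
  "(real^'n \<Rightarrow> complex) \<Rightarrow> real \<Rightarrow> ennreal \<Rightarrow> (int \<Rightarrow> real^'n \<Rightarrow> ennreal) \<Rightarrow>
     ((real^'n \<Rightarrow> complex) \<Rightarrow> complex) set" where
  "B_space \<phi> p q t = {f \<in> schwartz_inf_dual. B_norm \<phi> p q t f < \<infinity>}"

definition F_space ::
  "(real^'n \<Rightarrow> complex) \<Rightarrow> real \<Rightarrow> ennreal \<Rightarrow> (int \<Rightarrow> real^'n \<Rightarrow> ennreal) \<Rightarrow>
     ((real^'n \<Rightarrow> complex) \<Rightarrow> complex) set" where
  "F_space \<phi> p q t = {f \<in> schwartz_inf_dual. F_norm \<phi> p q t f < \<infinity>}"

definition equivalent_on :: "'a set \<Rightarrow> ('a \<Rightarrow> ennreal) \<Rightarrow> ('a \<Rightarrow> ennreal) \<Rightarrow> bool" where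
  "equivalent_on A N1 N2 \<longleftrightarrow> (\<exists>c C :: real. 0 < c \<and> 0 < C \<and>
     (\<forall>f\<in>A. ennreal c * N1 f \<le> N2 f \<and> N2 f \<le> ennreal C * N1 f))"

end

theory Submission
  imports Defs
begin

text \<open>The conditions defining \<^const>\<open>X_dot\<close> compare averages over cubes of \<^emph>\<open>every\<close> size, so by
  letting cubes shrink to a point they force all weights of the sequence to be comparable to each
  other pointwise almost everywhere, with constants that do not depend on the indices. Both
  quasi-norms are monotone and homogeneous in the weights, so such a change of the weights
  alters them by a bounded factor only, and the constant sequence \<open>t\<^sub>j\<close> gives the same spaces as
  \<open>{t\<^sub>k}\<close>.

  Only lower bounds of averages are used. If the product of two means \<open>M\<^bsub>Q,s\<^esub>(f) M\<^bsub>Q,r\<^esub>(g)\<close> is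
  at most \<open>C\<close> on all cubes, then \<open>f g \<le> C\<close> almost everywhere: otherwise
  there are levels \<open>a\<close>, \<open>b\<close> with \<open>a b > C\<close> such that \<open>{f > a, g > b}\<close> has positive measure, and on a
  cube filled almost completely by that set the product of the means is nearly \<open>a b\<close>
  (\<open>AE_mult_le_of_M_mean_mult_le\<close>). The first condition of \<^const>\<open>X_dot\<close> thereby gives
  \<open>t\<^sub>k \<le> C\<^sub>1 t\<^sub>j\<close> for \<open>k \<le> j\<close>. Multiplying the second condition by
  the first one for the pair \<open>(k, k)\<close> eliminates \<open>M\<^bsub>Q,p\<^esub>(t\<^sub>k)\<close> and leaves
  \<open>M\<^bsub>Q,\<sigma>\<^sub>2\<^esub>(t\<^sub>j) M\<^bsub>Q,\<sigma>\<^sub>1\<^esub>(1/t\<^sub>k) \<le> C\<^sub>1 C\<^sub>2\<close>,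
  that is, \<open>t\<^sub>j \<le> C\<^sub>1 C\<^sub>2 t\<^sub>k\<close> (\<open>X_dot_AE_comparable\<close>).\<close>

section \<open>Powers and integrals of extended nonnegative functions\<close>

lemma epowr_mono: "x \<le> y \<Longrightarrow> 0 \<le> s \<Longrightarrow> x epowr s \<le> y epowr s"
  unfolding epowr_def
  by (auto simp: top_unique intro!: ennreal_leI powr_mono2 enn2real_mono simp: less_top)

lemma epowr_ennreal: "0 \<le> c \<Longrightarrow> ennreal c epowr s = ennreal (c powr s)"
  by (simp add: epowr_def)

lemma epowr_cmult:
  assumes "0 < C" "0 < s"
  shows "(ennreal C * x) epowr s = ennreal (C powr s) * x epowr s"
proof (cases x)
  case (real r)
  then show ?thesis
    using assms by (simp add: epowr_def enn2real_mult powr_mult flip: ennreal_mult)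
next
  case top
  then show ?thesis
    using assms by (simp add: epowr_def ennreal_mult_top)
qed

text \<open>Homogeneity of the integral for an arbitrary, possibly nonmeasurable, integrand: the upper
  integral is a supremum over simple functions, and these can be rescaled. The integrands below contain
  \<open>\<phi>\<^sub>k * f\<close>, whose measurability would otherwise have to be derived from the continuity of
  the functional \<open>f\<close>.\<close>

lemma nn_integral_cmult_le:
  assumes "0 < C"
  shows "(\<integral>\<^sup>+x. ennreal C * f x \<partial>M) \<le> ennreal C * (\<integral>\<^sup>+x. f x \<partial>M)"
  unfolding nn_integral_def[of M "\<lambda>x. ennreal C * f x"]
proof (safe intro!: SUP_least)
  fix g assume g: "simple_function M g" "g \<le> (\<lambda>x. ennreal C * f x)"
  define h where "h = (\<lambda>x. ennreal (1 / C) * g x)"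
  have one: "ennreal C * ennreal (1 / C) = 1" "ennreal (1 / C) * ennreal C = 1"
    using assms by (auto simp flip: ennreal_mult)
  have h: "simple_function M h"
    unfolding h_def using g(1) by (intro simple_function_mult) auto
  have "h x \<le> f x" for x
  proof -
    have "h x \<le> ennreal (1 / C) * (ennreal C * f x)"
      unfolding h_def using g(2) by (intro mult_left_mono) (auto simp: le_fun_def)
    also have "\<dots> = f x" by (simp add: one flip: mult.assoc)
    finally show ?thesis .
  qed
  then have *: "integral\<^sup>S M h \<le> (\<integral>\<^sup>+x. f x \<partial>M)"
    unfolding nn_integral_def using h by (intro SUP_upper) (auto simp: le_fun_def)
  have "g = (\<lambda>x. ennreal C * h x)"
    by (simp add: h_def one fun_eq_iff flip: mult.assoc)
  then have "integral\<^sup>S M g = ennreal C * integral\<^sup>S M h"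
    using h by simp
  also have "\<dots> \<le> ennreal C * (\<integral>\<^sup>+x. f x \<partial>M)"
    by (intro mult_left_mono *) simp
  finally show "integral\<^sup>S M g \<le> ennreal C * (\<integral>\<^sup>+x. f x \<partial>M)" .
qed

section \<open>Monotonicity of the quasi-norms in the weights\<close>

lemma Lp_norm_le_cmult:
  assumes "0 < C" "0 < p" and le: "AE x in lebesgue. g x \<le> ennreal C * h x"
  shows "Lp_norm p g \<le> ennreal C * Lp_norm p h"
proof -
  have "(\<integral>\<^sup>+x. g x epowr p \<partial>lebesgue) \<le> (\<integral>\<^sup>+x. ennreal (C powr p) * h x epowr p \<partial>lebesgue)"
  proof (rule nn_integral_mono_AE)
    show "AE x in lebesgue. g x epowr p \<le> ennreal (C powr p) * h x epowr p"
      using le by eventually_elim (use assms in \<open>metis epowr_cmult epowr_mono less_imp_le\<close>)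
  qed
  also have "\<dots> \<le> ennreal (C powr p) * (\<integral>\<^sup>+x. h x epowr p \<partial>lebesgue)"
    using assms by (intro nn_integral_cmult_le) auto
  finally have "Lp_norm p g
      \<le> (ennreal (C powr p) * (\<integral>\<^sup>+x. h x epowr p \<partial>lebesgue)) epowr (1 / p)"
    unfolding Lp_norm_def using assms by (intro epowr_mono) auto
  also have "\<dots> = ennreal C * Lp_norm p h"
    unfolding Lp_norm_def using assms by (subst epowr_cmult) (auto simp: powr_powr)
  finally show ?thesis .
qed

lemma lq_norm_le_cmult:
  assumes "0 < C" "0 < q" and le: "\<And>k. a k \<le> ennreal C * b k"
  shows "lq_norm q a \<le> ennreal C * lq_norm q b"
proof (cases "q = \<infinity>")
  case True
  have "a k \<le> ennreal C * (SUP k. b k)" for k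
    by (rule order.trans[OF le]) (intro mult_left_mono SUP_upper; simp)
  then show ?thesis
    using True by (auto simp: lq_norm_def intro!: SUP_least)
next
  case False
  define r where "r = enn2real q"
  have r: "0 < r"
    using False assms(2) by (auto simp: r_def enn2real_positive_iff less_top)
  have "infsum (\<lambda>k. a k epowr r) UNIV \<le> ennreal (C powr r) * infsum (\<lambda>k. b k epowr r) UNIV"
    unfolding nonneg_infsum_complete[of UNIV "\<lambda>k. a k epowr r", simplified]
  proof (rule SUP_least)
    fix F :: "int set" assume F: "F \<in> {F. finite F}"
    have "(\<Sum>k\<in>F. a k epowr r) \<le> (\<Sum>k\<in>F. ennreal (C powr r) * b k epowr r)"
      using epowr_mono[OF le, of r] epowr_cmult[OF assms(1) r] r by (intro sum_mono) simp
    also have "\<dots> = ennreal (C powr r) * (\<Sum>k\<in>F. b k epowr r)"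
      by (simp add: sum_distrib_left)
    also have "\<dots> \<le> ennreal (C powr r) * infsum (\<lambda>k. b k epowr r) UNIV"
      unfolding nonneg_infsum_complete[of UNIV "\<lambda>k. b k epowr r", simplified]
      using F by (intro mult_left_mono SUP_upper) auto
    finally show "(\<Sum>k\<in>F. a k epowr r) \<le> ennreal (C powr r) * infsum (\<lambda>k. b k epowr r) UNIV" .
  qed
  then have "lq_norm q a
      \<le> (ennreal (C powr r) * infsum (\<lambda>k. b k epowr r) UNIV) epowr (1 / r)"
    unfolding lq_norm_def r_def[symmetric] using r False by (auto intro!: epowr_mono)
  also have "\<dots> = ennreal C * lq_norm q b"
    unfolding lq_norm_def r_def[symmetric]
    using False r assms by (subst epowr_cmult) (auto simp: powr_powr)
  finally show ?thesis .
qed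

lemma B_norm_le_cmult:
  assumes "0 < C" "0 < p" "0 < q" and le: "\<And>k. AE x in lebesgue. s k x \<le> ennreal C * u k x"
  shows "B_norm \<phi> p q s f \<le> ennreal C * B_norm \<phi> p q u f"
  unfolding B_norm_def
proof (rule lq_norm_le_cmult[OF assms(1,3)], rule Lp_norm_le_cmult[OF assms(1,2)])
  fix k
  show "AE x in lebesgue. s k x * ennreal (norm (conv (dilate \<phi> k) f x))
      \<le> ennreal C * (u k x * ennreal (norm (conv (dilate \<phi> k) f x)))"
    using le[of k]
    by eventually_elim (auto simp flip: mult.assoc intro: mult_right_mono)
qed

lemma F_norm_le_cmult:
  assumes "0 < C" "0 < p" "0 < q" and le: "\<And>k. AE x in lebesgue. s k x \<le> ennreal C * u k x"
  shows "F_norm \<phi> p q s f \<le> ennreal C * F_norm \<phi> p q u f"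
  unfolding F_norm_def
proof (rule Lp_norm_le_cmult[OF assms(1,2)])
  have "AE x in lebesgue. \<forall>k. s k x \<le> ennreal C * u k x"
    using le by (simp add: AE_all_countable)
  then show "AE x in lebesgue. lq_norm q (\<lambda>k. s k x * ennreal (norm (conv (dilate \<phi> k) f x)))
      \<le> ennreal C * lq_norm q (\<lambda>k. u k x * ennreal (norm (conv (dilate \<phi> k) f x)))"
    by eventually_elim
       (intro lq_norm_le_cmult assms, auto simp flip: mult.assoc intro: mult_right_mono)
qed

lemma equivalent_on_of_le_cmult:
  assumes "0 < C" "\<And>f. N1 f \<le> ennreal C * N2 f" "\<And>f. N2 f \<le> ennreal C * N1 f"
  shows "equivalent_on A N1 N2"
  unfolding equivalent_on_def
proof (rule exI[of _ "1 / C"], rule exI[of _ C], intro conjI ballI)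
  fix f
  have "ennreal (1 / C) * N1 f \<le> ennreal (1 / C) * (ennreal C * N2 f)"
    by (intro mult_left_mono assms) auto
  also have "\<dots> = N2 f"
    using assms(1) by (simp flip: mult.assoc ennreal_mult)
  finally show "ennreal (1 / C) * N1 f \<le> N2 f" .
qed (use assms in auto)

lemma less_top_iff_of_le_cmult:
  fixes x y :: ennreal
  assumes "x \<le> ennreal C * y" "y \<le> ennreal C * x"
  shows "x < \<infinity> \<longleftrightarrow> y < \<infinity>"
  using assms by (auto simp: ennreal_mult_less_top intro: le_less_trans)

section \<open>From means over cubes to pointwise bounds\<close>

lemma cube_lmeasurable:
  fixes Q :: "(real^'n) set"
  assumes "cube Q"
  shows "Q \<in> lmeasurable" "0 < measure lebesgue Q"
proof -
  obtain a l where l: "0 < l" and Q: "Q = cbox a (\<chi> i. a $ i + l)"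
    using assms by (auto simp: cube_def)
  show "Q \<in> lmeasurable" by (simp add: Q)
  have "Q \<noteq> {}" using l by (simp add: Q interval_ne_empty_cart less_imp_le)
  then show "0 < measure lebesgue Q"
    using l by (simp add: Q content_cbox_cart)
qed

text \<open>Lebesgue differentiation of the indicator of \<open>E\<close>: almost every point of
  \<open>E\<close> is the lower corner of small cubes filled by \<open>E\<close> up to an arbitrarily small proportion.\<close>

lemma exists_cube_density:
  fixes E :: "(real^'n) set"
  assumes E: "E \<in> sets lebesgue" and pos: "emeasure lebesgue E \<noteq> 0" and \<delta>: "\<delta> < 1"
  shows "\<exists>Q. cube Q \<and> \<delta> * measure lebesgue Q \<le> measure lebesgue (E \<inter> Q)"
proof -
  have "(indicator E :: _ \<Rightarrow> real) integrable_on cbox a b" for a b :: "real^'n"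
  proof -
    have "E \<inter> cbox a b \<in> lmeasurable"
      using E by (subst Int_commute) (intro fmeasurable_Int_fmeasurable; simp)
    then show ?thesis
      by (simp add: integrable_on_indicator Int_commute)
  qed
  then obtain N :: "(real^'n) set" where N: "negligible N"
    and lim: "\<And>x e. x \<notin> N \<Longrightarrow> 0 < e \<Longrightarrow> \<exists>d>0. \<forall>h. 0 < h \<and> h < d \<longrightarrow>
        norm (integral (cbox x (x + h *\<^sub>R One)) (indicator E :: _ \<Rightarrow> real) /\<^sub>R h ^ DIM(real^'n)
          - indicator E x) < e"
    using integrable_ccontinuous_explicit[of "indicator E :: _ \<Rightarrow> real"] by blast
  have "\<not> E \<subseteq> N"
    using pos N negligible_subset[of N E]
    by (auto simp: negligible_iff_null_sets null_sets_def)
  then obtain x where x: "x \<in> E" "x \<notin> N" by auto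
  obtain d where d: "0 < d" and close: "\<And>h. 0 < h \<Longrightarrow> h < d \<Longrightarrow>
        norm (integral (cbox x (x + h *\<^sub>R One)) (indicator E :: _ \<Rightarrow> real) /\<^sub>R h ^ DIM(real^'n)
          - indicator E x) < 1 - \<delta>"
    using lim[OF x(2), of "1 - \<delta>"] \<delta> by auto
  define h where "h = d / 2"
  have h: "0 < h" "h < d" using d by (auto simp: h_def)
  define Q where "Q = cbox x (\<chi> i. x $ i + h)"
  have corner: "x + h *\<^sub>R One = (\<chi> i. x $ i + h)"
  proof -
    have "(One :: real^'n) $ i = 1" for i
      by (simp add: cart_eq_inner_axis axis_in_Basis_iff inner_sum_Basis)
    then show ?thesis by (simp add: vec_eq_iff)
  qed
  have Q: "cube Q" unfolding cube_def Q_def using h by blast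
  have vol: "measure lebesgue Q = h ^ CARD('n)"
  proof -
    have "Q \<noteq> {}" using h by (simp add: Q_def interval_ne_empty_cart less_imp_le)
    then show ?thesis by (simp add: Q_def content_cbox_cart)
  qed
  have int: "integral Q (indicator E :: _ \<Rightarrow> real) = measure lebesgue (E \<inter> Q)"
  proof -
    have "E \<inter> Q \<in> lmeasurable"
      using E by (subst Int_commute) (intro fmeasurable_Int_fmeasurable; simp add: Q_def)
    then show ?thesis
      by (simp add: integral_indicator Int_commute)
  qed
  have "\<bar>measure lebesgue (E \<inter> Q) / h ^ CARD('n) - 1\<bar> < 1 - \<delta>"
    using close[OF h] x(1) unfolding corner Q_def[symmetric] int
    by (simp add: divide_inverse mult.commute)
  then have "\<delta> \<le> measure lebesgue (E \<inter> Q) / h ^ CARD('n)"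
    by linarith
  then show ?thesis
    using Q h by (intro exI[of _ Q]) (simp add: vol pos_le_divide_eq)
qed

text \<open>Restricting the average to \<open>E \<inter> Q\<close>, where \<open>f \<ge> c\<close>, loses only the factor
  \<open>\<delta>\<close> under the \<open>s\<close>-th root. The bound covers \<open>s = \<infinity>\<close> too, because then \<open>1 / enn2real s = 1 / 0 = 0\<close> and the
  factor is \<open>\<delta> powr 0 = 1\<close>.\<close>

lemma M_mean_ge:
  fixes f :: "real^'n \<Rightarrow> ennreal" and c \<delta> :: real
  assumes Q: "cube Q" and E: "E \<in> sets lebesgue" and s: "s \<noteq> 0" and "0 \<le> c" "0 < \<delta>"
    and dens: "\<delta> * measure lebesgue Q \<le> measure lebesgue (E \<inter> Q)"
    and ge: "\<And>x. x \<in> E \<Longrightarrow> ennreal c \<le> f x"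
  shows "ennreal (c * \<delta> powr (1 / enn2real s)) \<le> M_mean Q s f"
proof -
  note Q' = cube_lmeasurable[OF Q]
  have EQ: "E \<inter> Q \<in> lmeasurable"
    using E Q' by (subst Int_commute) (intro fmeasurable_Int_fmeasurable)
  have pos: "0 < measure lebesgue (E \<inter> Q)"
    using dens Q' \<open>0 < \<delta>\<close> by (meson less_le_trans mult_pos_pos)
  show ?thesis
  proof (cases "s = \<infinity>")
    case True
    have "ennreal c \<le> esssup (restrict_space lebesgue Q) f"
    proof (rule ccontr)
      assume "\<not> ?thesis"
      then have less: "esssup (restrict_space lebesgue Q) f < ennreal c" by simp
      have "AE x in restrict_space lebesgue Q. x \<notin> E"
        using esssup_AE[of f "restrict_space lebesgue Q"]
        by eventually_elim (use ge less in \<open>meson leD le_less_trans\<close>)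
      then have "AE x in lebesgue. x \<notin> E \<inter> Q"
        using Q' by (subst (asm) AE_restrict_space_iff) (auto elim: eventually_mono)
      then have "emeasure lebesgue (E \<inter> Q) = 0"
        using EQ by (subst (asm) AE_iff_measurable[of "E \<inter> Q"]) auto
      then show False using pos by (simp add: measure_def)
    qed
    then show ?thesis
      using True \<open>0 < \<delta>\<close> by (simp add: M_mean_def)
  next
    case False
    define r where "r = enn2real s"
    have r: "0 < r"
      using False s by (auto simp: r_def enn2real_positive_iff less_top zero_less_iff_neq_zero)
    have "ennreal (c powr r * \<delta> * measure lebesgue Q)
        \<le> ennreal (c powr r * measure lebesgue (E \<inter> Q))"
      using mult_left_mono[OF dens, of "c powr r"] by (intro ennreal_leI) (simp add: mult.assoc)
    also have "\<dots> = ennreal (c powr r) * emeasure lebesgue (E \<inter> Q)"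
      using EQ by (simp add: ennreal_mult emeasure_eq_measure2)
    also have "\<dots> = (\<integral>\<^sup>+x. ennreal (c powr r) * indicator (E \<inter> Q) x \<partial>lebesgue)"
      using EQ by (intro nn_integral_cmult_indicator[symmetric]) auto
    also have "\<dots> \<le> (\<integral>\<^sup>+x\<in>Q. f x epowr r \<partial>lebesgue)"
    proof (rule nn_integral_mono)
      fix x
      show "ennreal (c powr r) * indicator (E \<inter> Q) x \<le> f x epowr r * indicator Q x"
        using epowr_mono[OF ge, of x r] r \<open>0 \<le> c\<close>
        by (auto simp: epowr_ennreal indicator_def)
    qed
    finally have int: "ennreal (c powr r * \<delta> * measure lebesgue Q)
        \<le> (\<integral>\<^sup>+x\<in>Q. f x epowr r \<partial>lebesgue)" .
    have "ennreal (c powr r * \<delta>)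
        = ennreal (c powr r * \<delta> * measure lebesgue Q) / emeasure lebesgue Q"
      using Q' \<open>0 < \<delta>\<close> by (simp add: emeasure_eq_measure2 divide_ennreal)
    also have "\<dots> \<le> (\<integral>\<^sup>+x\<in>Q. f x epowr r \<partial>lebesgue) / emeasure lebesgue Q"
      using int by (rule divide_right_mono_ennreal)
    finally have "ennreal (c powr r * \<delta>) epowr (1 / r) \<le> M_mean Q s f"
      unfolding M_mean_def r_def[symmetric] using False r by (auto intro!: epowr_mono)
    moreover have "ennreal (c powr r * \<delta>) epowr (1 / r) = ennreal (c * \<delta> powr (1 / r))"
      using r \<open>0 \<le> c\<close> \<open>0 < \<delta>\<close> by (simp add: epowr_ennreal powr_mult powr_powr)
    ultimately show ?thesis by (simp add: r_def)
  qed
qed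

lemma ennreal_mult_gt_rationals:
  fixes a b C :: ennreal
  assumes "C < a * b"
  obtains c d :: rat where "0 \<le> c" "0 \<le> d" "ennreal (of_rat c) < a" "ennreal (of_rat d) < b"
    "C < ennreal (of_rat c * of_rat d)"
proof -
  have below: "\<exists>c<x. y < c * z" if "y < x * z" for x y z :: ennreal
  proof -
    have "x * z = (SUP c\<in>{..<x}. c * z)"
      by (simp add: SUP_mult_right_ennreal[symmetric])
    then show ?thesis using that by (auto simp: less_SUP_iff)
  qed
  obtain c' where c': "c' < a" "C < c' * b" using below[OF assms] by blast
  obtain d' where d': "d' < b" "C < d' * c'" using below[of C b c'] c'(2) by (auto simp: mult.commute)
  obtain c :: rat where c: "c' < ennreal (of_rat c)" "ennreal (of_rat c) < a"
    using ennreal_rat_dense[OF c'(1)] by auto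
  obtain d :: rat where d: "d' < ennreal (of_rat d)" "ennreal (of_rat d) < b"
    using ennreal_rat_dense[OF d'(1)] by auto
  have pos: "0 < (of_rat c :: real)" "0 < (of_rat d :: real)"
    using c(1) d(1) by (metis ennreal_neg linorder_not_less not_less_zero)+
  note d'(2)
  also have "d' * c' \<le> ennreal (of_rat d) * ennreal (of_rat c)"
    using c(1) d(1) by (intro mult_mono) auto
  also have "\<dots> = ennreal (of_rat c * of_rat d)"
    using pos by (simp add: ennreal_mult mult.commute)
  finally show ?thesis
    using that[of c d] c d pos by simp
qed

text \<open>Rational levels reduce the exceptional set to countably many sets
  \<open>{f > c, g > d}\<close> with \<open>c d > C\<close>, each of which is null by the density argument.\<close>

lemma AE_mult_le_of_M_mean_mult_le:
  fixes f g :: "real^'n \<Rightarrow> ennreal"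
  assumes [measurable]: "f \<in> borel_measurable lebesgue" "g \<in> borel_measurable lebesgue"
    and s: "s \<noteq> 0" and r: "r \<noteq> 0" and "0 \<le> C"
    and le: "\<And>Q. cube Q \<Longrightarrow> M_mean Q s f * M_mean Q r g \<le> ennreal C"
  shows "AE x in lebesgue. f x * g x \<le> ennreal C"
proof -
  have null: "AE x in lebesgue. \<not> (ennreal (of_rat c) < f x \<and> ennreal (of_rat d) < g x)"
    if c: "0 \<le> c" and d: "0 \<le> d" and gt: "ennreal C < ennreal (of_rat c * of_rat d)" for c d :: rat
  proof -
    define E where "E = {x. ennreal (of_rat c) < f x \<and> ennreal (of_rat d) < g x}"
    have "{x \<in> space lebesgue. ennreal (of_rat c) < f x \<and> ennreal (of_rat d) < g x} \<in> sets lebesgue"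
      by measurable
    then have E: "E \<in> sets lebesgue" by (simp add: E_def)
    have "emeasure lebesgue E = 0"
    proof (rule ccontr)
      assume nz: "emeasure lebesgue E \<noteq> 0"
      define \<alpha> where "\<alpha> = 1 / enn2real s"
      define \<beta> where "\<beta> = 1 / enn2real r"
      have "(of_rat c * \<delta> powr \<alpha>) * (of_rat d * \<delta> powr \<beta>) \<le> C" if \<delta>: "0 < \<delta>" "\<delta> < 1" for \<delta> :: real
      proof -
        obtain Q where Q: "cube Q" and dens: "\<delta> * measure lebesgue Q \<le> measure lebesgue (E \<inter> Q)"
          using exists_cube_density[OF E nz \<delta>(2)] by blast
        have "ennreal (of_rat c * \<delta> powr \<alpha>) \<le> M_mean Q s f"
          unfolding \<alpha>_def using c
          by (intro M_mean_ge[OF Q E s _ \<delta>(1) dens]) (auto simp: E_def)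
        moreover have "ennreal (of_rat d * \<delta> powr \<beta>) \<le> M_mean Q r g"
          unfolding \<beta>_def using d
          by (intro M_mean_ge[OF Q E r _ \<delta>(1) dens]) (auto simp: E_def)
        ultimately have "ennreal (of_rat c * \<delta> powr \<alpha>) * ennreal (of_rat d * \<delta> powr \<beta>) \<le> ennreal C"
          using le[OF Q] mult_mono[of _ "M_mean Q s f" _ "M_mean Q r g"] by (meson order.trans zero_le)
        then show ?thesis
          using \<open>0 \<le> C\<close> c d by (simp flip: ennreal_mult)
      qed
      (* fuller and fuller cubes: \<delta> tends to 1 *)
      then have "\<forall>\<^sub>F \<delta> in at_left 1. (of_rat c * \<delta> powr \<alpha>) * (of_rat d * \<delta> powr \<beta>) \<le> C"
        by (auto simp: eventually_at_left[of 0 "1::real"] intro!: exI[of _ 0])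
      moreover have "((\<lambda>\<delta>. (of_rat c * \<delta> powr \<alpha>) * (of_rat d * \<delta> powr \<beta>))
          \<longlongrightarrow> (of_rat c * 1 powr \<alpha>) * (of_rat d * 1 powr \<beta>)) (at_left (1::real))"
        by (intro tendsto_intros) auto
      ultimately have "of_rat c * of_rat d \<le> C"
        using tendsto_upperbound by fastforce
      then show False
        using gt by (metis ennreal_leI leD)
    qed
    then show ?thesis
      using E by (subst AE_iff_measurable[of E]) (auto simp: E_def)
  qed
  have "AE x in lebesgue. \<forall>c d :: rat. 0 \<le> c \<longrightarrow> 0 \<le> d \<longrightarrow>
      ennreal C < ennreal (of_rat c * of_rat d) \<longrightarrow>
      \<not> (ennreal (of_rat c) < f x \<and> ennreal (of_rat d) < g x)"
    using null by (simp add: AE_all_countable AE_impI)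
  then show ?thesis
  proof eventually_elim
    case (elim x)
    show ?case
    proof (rule ccontr)
      assume "\<not> f x * g x \<le> ennreal C"
      then have "ennreal C < f x * g x" by simp
      then show False
        using elim by (elim ennreal_mult_gt_rationals) blast
    qed
  qed
qed

section \<open>Comparability of the weights\<close>

lemma ennreal_inverse_mult_self:
  fixes m :: ennreal
  shows "m \<noteq> 0 \<Longrightarrow> m \<noteq> \<infinity> \<Longrightarrow> inverse m * m = 1"
  using ennreal_divide_self[of m] by (simp add: divide_ennreal_def mult.commute less_top)

text \<open>The extreme cases \<open>m = 0\<close> and \<open>m = \<infinity>\<close> force \<open>a = 0\<close> or
  \<open>b = 0\<close>, and then \<open>a * b = 0\<close> because \<open>0 * \<infinity> = 0\<close>.\<close>

lemma ennreal_mult_le_eliminate: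
  fixes m a b A B :: ennreal
  assumes "inverse m * a \<le> A" "m * b \<le> B" "A < \<infinity>" "B < \<infinity>"
  shows "a * b \<le> B * A"
proof -
  consider "m = 0" | "m = \<infinity>" | "m \<noteq> 0" "m \<noteq> \<infinity>" by auto
  then show ?thesis
  proof cases
    case 1
    then have "a = 0" using assms by (auto simp: ennreal_top_mult top_unique split: if_splits)
    then show ?thesis by simp
  next
    case 2
    then have "b = 0" using assms by (auto simp: ennreal_top_mult top_unique split: if_splits)
    then show ?thesis by simp
  next
    case 3
    have "a * b = (m * inverse m) * (a * b)"
      using 3 by (simp add: mult.commute[of m] ennreal_inverse_mult_self)
    also have "\<dots> = (m * b) * (inverse m * a)" by (simp add: ac_simps)
    also have "\<dots> \<le> B * A" using assms by (intro mult_mono) auto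
    finally show ?thesis .
  qed
qed

lemma ennreal_le_mult_of_mult_inverse_le:
  fixes a b C :: ennreal
  assumes "a * inverse b \<le> C" "0 < b" "b < \<infinity>"
  shows "a \<le> C * b"
proof -
  have "a = a * inverse b * b"
    using assms by (simp add: mult.assoc ennreal_inverse_mult_self)
  also have "\<dots> \<le> C * b" using assms(1) by (intro mult_right_mono) auto
  finally show ?thesis .
qed

lemma X_dot_AE_comparable:
  fixes t :: "int \<Rightarrow> real^'n \<Rightarrow> ennreal"
  assumes w: "\<And>k. weight (t k)" and X: "t \<in> X_dot \<sigma> p"
    and p: "0 < p" and \<sigma>: "fst \<sigma> \<noteq> 0" "snd \<sigma> \<noteq> 0"
  shows "\<exists>C>0. \<forall>k j. AE x in lebesgue. t k x \<le> ennreal C * t j x"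
proof -
  obtain C1 C2 :: real where C: "0 < C1" "0 < C2"
    and 1: "\<And>k j Q. k \<le> j \<Longrightarrow> cube Q \<Longrightarrow>
      M_mean Q (ennreal p) (t k) * M_mean Q (fst \<sigma>) (\<lambda>x. inverse (t j x)) \<le> ennreal C1"
    and 2: "\<And>k j Q. k \<le> j \<Longrightarrow> cube Q \<Longrightarrow>
      inverse (M_mean Q (ennreal p) (t k)) * M_mean Q (snd \<sigma>) (t j) \<le> ennreal C2"
    using X unfolding X_dot_def by blast
  have meas [measurable]: "t k \<in> borel_measurable lebesgue" for k
    using w[of k] by (simp add: weight_def)
  have fin: "AE x in lebesgue. 0 < t k x \<and> t k x < \<infinity>" for k
    using w[of k] by (simp add: weight_def)
  have up: "AE x in lebesgue. t k x \<le> ennreal C1 * t j x" if "k \<le> j" for k j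
  proof -
    have "AE x in lebesgue. t k x * inverse (t j x) \<le> ennreal C1"
      by (rule AE_mult_le_of_M_mean_mult_le[OF _ _ _ \<sigma>(1) _ 1[OF that]])
         (use p C in auto)
    then show ?thesis
      using fin[of j] by eventually_elim (simp add: ennreal_le_mult_of_mult_inverse_le)
  qed
  have down: "AE x in lebesgue. t j x \<le> ennreal (C1 * C2) * t k x" if "k \<le> j" for k j
  proof -
    have "M_mean Q (snd \<sigma>) (t j) * M_mean Q (fst \<sigma>) (\<lambda>x. inverse (t k x)) \<le> ennreal (C1 * C2)"
      if "cube Q" for Q
      \<comment> \<open>The second condition for \<open>(k, j)\<close> and the first for \<open>(k, k)\<close> share the mean of \<open>t k\<close>.\<close>
      using ennreal_mult_le_eliminate[OF 2[OF \<open>k \<le> j\<close> that] 1[OF order.refl that]] C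
      by (simp add: ennreal_mult)
    then have "AE x in lebesgue. t j x * inverse (t k x) \<le> ennreal (C1 * C2)"
      by (intro AE_mult_le_of_M_mean_mult_le[OF _ _ \<sigma>(2,1)]) (use C in auto)
    then show ?thesis
      using fin[of k] by eventually_elim (simp add: ennreal_le_mult_of_mult_inverse_le)
  qed
  define C where "C = max C1 (C1 * C2)"
  have "AE x in lebesgue. t k x \<le> ennreal C * t j x" for k j
  proof (cases "k \<le> j")
    case True
    have "ennreal C1 \<le> ennreal C" by (auto simp: C_def intro: ennreal_leI)
    from up[OF True] show ?thesis
      by eventually_elim (erule order.trans, intro mult_right_mono, fact, simp)
  next
    case False
    then have "j \<le> k" by simp
    have "ennreal (C1 * C2) \<le> ennreal C" by (auto simp: C_def intro: ennreal_leI)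
    from down[OF \<open>j \<le> k\<close>] show ?thesis
      by eventually_elim (erule order.trans, intro mult_right_mono, fact, simp)
  qed
  moreover have "0 < C" using C by (simp add: C_def)
  ultimately show ?thesis by blast
qed

theorem theorem3p20:
  fixes \<phi> :: "real^'n \<Rightarrow> complex"
    and t :: "int \<Rightarrow> real^'n \<Rightarrow> ennreal"
    and \<theta> p :: real and q :: ennreal and \<sigma> :: "ennreal \<times> ennreal" and j :: int
  assumes "admissible_kernel \<phi>"
    and "0 < \<theta>" "\<theta> < p" "0 < q"
    and "p_admissible p t"
    and "t \<in> X_dot \<sigma> p"
    and "fst \<sigma> = ennreal \<theta> * conj_exponent (ennreal (p / \<theta>))"
    and "ennreal p \<le> snd \<sigma>"
  shows "B_space \<phi> p q t = B_space \<phi> p q (\<lambda>k. t j) \<and>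
         equivalent_on (B_space \<phi> p q t) (B_norm \<phi> p q t) (B_norm \<phi> p q (\<lambda>k. t j)) \<and>
         F_space \<phi> p q t = F_space \<phi> p q (\<lambda>k. t j) \<and>
         equivalent_on (F_space \<phi> p q t) (F_norm \<phi> p q t) (F_norm \<phi> p q (\<lambda>k. t j))"
proof -
  have p: "0 < p" using assms(2,3) by linarith
  have "fst \<sigma> \<noteq> 0"
  proof -
    have "1 - inverse (ennreal (p / \<theta>)) \<noteq> top"
      by (simp add: ennreal_minus_eq_top)
    then have "conj_exponent (ennreal (p / \<theta>)) \<noteq> 0"
      by (simp add: conj_exponent_def)
    then show ?thesis using assms(2,7) by simp
  qed
  moreover have "snd \<sigma> \<noteq> 0" using p assms(8) by auto
  moreover have "weight (t k)" for k using assms(5) by (simp add: p_admissible_def)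
  ultimately obtain C where C: "0 < C" and le: "\<And>k j. AE x in lebesgue. t k x \<le> ennreal C * t j x"
    using X_dot_AE_comparable[OF _ assms(6) p] by blast
  note B = B_norm_le_cmult[of C p q t "\<lambda>k. t j" \<phi>, OF C p assms(4) le]
    B_norm_le_cmult[of C p q "\<lambda>k. t j" t \<phi>, OF C p assms(4) le]
  note F = F_norm_le_cmult[of C p q t "\<lambda>k. t j" \<phi>, OF C p assms(4) le]
    F_norm_le_cmult[of C p q "\<lambda>k. t j" t \<phi>, OF C p assms(4) le]
  show ?thesis
    unfolding B_space_def F_space_def
    using less_top_iff_of_le_cmult[OF B] less_top_iff_of_le_cmult[OF F]
    by (simp add: equivalent_on_of_le_cmult[OF C B] equivalent_on_of_le_cmult[OF C F])
qed

end
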